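(* Let $b\in\mathbb{Q}$ and let $\phi(z)=z+\frac{b}{z}$. Then $\phi$ has no points in $\mathbb{P}^1(\mathbb{Q})$ of exact period $n$ for any $n\ge 5$.
   Context: A point $P$ has exact period $n$ under $\phi$ if $\phi^n(P)=P$ and $\phi^m(P)\neq P$ for $0<m<n$, where $\phi^n$ denotes the $n$-th iterate. *)

theory Defs
  imports "HOL-Computational_Algebra.Computational_Algebra" "HOL-Computational_Algebra.Field_as_Ring"
begin

definition proj_rel :: "'a::field \<times> 'a \<Rightarrow> 'a \<times> 'a \<Rightarrow> bool" where
  "proj_rel u v \<longleftrightarrow> u \<noteq> (0, 0) \<and> v \<noteq> (0, 0) \<and>
     (\<exists>c. c \<noteq> 0 \<and> fst v = c * fst u \<and> snd v = c * snd u)"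

lemma part_equivp_proj_rel: "part_equivp (proj_rel :: 'a::field \<times> 'a \<Rightarrow> _)"
proof (rule part_equivpI)
  show "\<exists>u :: 'a \<times> 'a. proj_rel u u"
    by (rule exI[of _ "(1, 0)"]) (auto simp: proj_rel_def intro: exI[of _ 1])
  show "symp (proj_rel :: 'a \<times> 'a \<Rightarrow> _)"
  proof (rule sympI)
    fix u v :: "'a \<times> 'a"
    assume "proj_rel u v"
    then obtain c where c: "u \<noteq> (0, 0)" "v \<noteq> (0, 0)" "c \<noteq> 0"
      "fst v = c * fst u" "snd v = c * snd u"
      by (auto simp: proj_rel_def)
    then show "proj_rel v u"
      unfolding proj_rel_def by (intro conjI exI[of _ "inverse c"]) auto
  qed
  show "transp (proj_rel :: 'a \<times> 'a \<Rightarrow> _)"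
  proof (rule transpI)
    fix u v w :: "'a \<times> 'a"
    assume "proj_rel u v" "proj_rel v w"
    then obtain c d where "u \<noteq> (0, 0)" "w \<noteq> (0, 0)" "c \<noteq> 0" "d \<noteq> 0"
      "fst v = c * fst u" "snd v = c * snd u" "fst w = d * fst v" "snd w = d * snd v"
      by (auto simp: proj_rel_def)
    then show "proj_rel u w"
      unfolding proj_rel_def by (intro conjI exI[of _ "d * c"]) auto
  qed
qed

text \<open>The projective line \<open>P\<^sup>1(K)\<close>: classes \<open>[x : y]\<close> of nonzero pairs up to scaling.\<close>

quotient_type (overloaded) 'a proj_line = "'a::field \<times> 'a" / partial: proj_rel
  by (rule part_equivp_proj_rel)

definition homog :: "nat \<Rightarrow> 'a::comm_semiring_1 poly \<Rightarrow> 'a \<Rightarrow> 'a \<Rightarrow> 'a" where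
  "homog d p x y = (\<Sum>i\<le>d. coeff p i * x ^ i * y ^ (d - i))"

lemma homog_scale: "homog d p (c * x) (c * y) = c ^ d * homog d p x y"
proof -
  have "coeff p i * (c * x) ^ i * (c * y) ^ (d - i) =
        c ^ d * (coeff p i * x ^ i * y ^ (d - i))" if "i \<le> d" for i
  proof -
    have "c ^ d = c ^ i * c ^ (d - i)"
      using that by (simp flip: power_add)
    then show ?thesis
      by (simp add: power_mult_distrib mult_ac)
  qed
  then show ?thesis
    by (simp add: homog_def sum_distrib_left)
qed

lemma homog_affine:
  fixes p :: "'a::field poly"
  assumes "degree p \<le> d"
  shows "homog d p x 1 = poly p x"
proof -
  have "poly p x = (\<Sum>i\<le>d. coeff p i * x ^ i)"
    using assms by (intro poly_altdef[THEN trans] sum.mono_neutral_left) (auto simp: coeff_eq_0)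
  then show ?thesis
    by (simp add: homog_def)
qed

lemma homog_infinity: "homog d p x 0 = coeff p d * x ^ d"
proof -
  have "homog d p x 0 = (\<Sum>i\<le>d. if i = d then coeff p d * x ^ d else 0)"
    unfolding homog_def by (rule sum.cong) (auto simp: power_0_left)
  then show ?thesis
    by simp
qed

lemma homog_coprime_nonzero:
  fixes p q :: "'a::field_gcd poly"
  assumes "coprime p q" "q \<noteq> 0" "(x, y) \<noteq> (0, 0)" "d = max (degree p) (degree q)"
  shows "(homog d p x y, homog d q x y) \<noteq> (0, 0)"
proof (cases "y = 0")
  case True
  then have "x \<noteq> 0"
    using assms by simp
  moreover have "coeff p d \<noteq> 0 \<or> coeff q d \<noteq> 0"
    using assms by (metis degree_0 leading_coeff_0_iff max.commute max_0L max_def)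
  ultimately show ?thesis
    using True by (auto simp: homog_infinity)
next
  case False
  have scale: "homog d r x y = y ^ d * poly r (x / y)" if "degree r \<le> d" for r
    using homog_scale[of d r y "x / y" 1] homog_affine[OF that] False by simp
  have "\<not> (poly p (x / y) = 0 \<and> poly q (x / y) = 0)"
    using assms(1) coprime_poly_0 by blast
  moreover have "degree p \<le> d" "degree q \<le> d"
    using assms(4) by simp_all
  ultimately show ?thesis
    using False by (auto simp: scale)
qed

text \<open>
  A rational function \<open>f = p / q\<close> in lowest terms, with \<open>d = max (deg p) (deg q)\<close>, acts on the
  projective line by \<open>[x : y] \<mapsto> [y\<^sup>d p(x/y) : y\<^sup>d q(x/y)]\<close>. Reducing to lowest terms makes
  this a morphism without base points.
\<close>

lift_definition rat_fun_map :: "'a::field_gcd poly fract \<Rightarrow> 'a proj_line \<Rightarrow> 'a proj_line" is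
  "\<lambda>f (x, y).
     let (p, q) = quot_of_fract f; d = max (degree p) (degree q)
     in (homog d p x y, homog d q x y)"
proof -
  fix f :: "'a poly fract" and u v :: "'a \<times> 'a"
  assume uv: "proj_rel u v"
  obtain p q where pq: "quot_of_fract f = (p, q)"
    by fastforce
  define d where "d = max (degree p) (degree q)"
  have cop: "coprime p q" and q0: "q \<noteq> 0"
    using coprime_quot_of_fract[of f] snd_quot_of_fract_nonzero[of f] by (simp_all add: pq)
  obtain x y x' y' where xy: "u = (x, y)" "v = (x', y')"
    by fastforce
  obtain c where c: "c \<noteq> 0" "x' = c * x" "y' = c * y"
    using uv xy by (auto simp: proj_rel_def)
  have "(x, y) \<noteq> (0, 0)" "(x', y') \<noteq> (0, 0)"
    using uv xy by (auto simp: proj_rel_def)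
  then have "(homog d p x y, homog d q x y) \<noteq> (0, 0)" "(homog d p x' y', homog d q x' y') \<noteq> (0, 0)"
    using homog_coprime_nonzero[OF cop q0 _ d_def] by blast+
  then have "proj_rel (homog d p x y, homog d q x y) (homog d p x' y', homog d q x' y')"
    unfolding proj_rel_def using c by (auto simp: homog_scale intro!: exI[of _ "c ^ d"])
  then show "proj_rel
      ((\<lambda>(x, y). let (p, q) = quot_of_fract f; d = max (degree p) (degree q)
         in (homog d p x y, homog d q x y)) u)
      ((\<lambda>(x, y). let (p, q) = quot_of_fract f; d = max (degree p) (degree q)
         in (homog d p x y, homog d q x y)) v)"
    by (simp add: xy pq d_def Let_def)
qed

definition exact_period :: "('a \<Rightarrow> 'a) \<Rightarrow> nat \<Rightarrow> 'a \<Rightarrow> bool" where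
  "exact_period f n P \<longleftrightarrow>
     0 < n \<and> (f ^^ n) P = P \<and> (\<forall>m. 0 < m \<and> m < n \<longrightarrow> (f ^^ m) P \<noteq> P)"

definition phi :: "'a::field_gcd \<Rightarrow> 'a poly fract" where
  "phi b = (let z = to_fract [:0, 1:] in z + to_fract [:b:] / z)"

end

theory Submission
  imports Defs
begin

text \<open>
  Fix a prime \<open>p\<close> and let \<open>v\<close> be the \<open>p\<close>-adic valuation. From \<open>z \<phi>(z) = z\<^sup>2 + b\<close> one reads off that
  \<open>2 v(z) < v(b)\<close> implies \<open>v(\<phi>(z)) = v(z)\<close>, and \<open>2 v(z) > v(b)\<close> implies \<open>2 v(\<phi>(z)) < v(b)\<close>. Hence
  \<open>v\<close> is constant along every cycle of nonzero finite points: either \<open>2 v(z) = v(b)\<close>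
  throughout, or the cycle is trapped in the region \<open>2 v(z) < v(b)\<close>. As this holds for all \<open>p\<close>,
  such a cycle is contained in \<open>{z, -z}\<close>. So \<open>\<phi>\<close> has in fact no rational point of exact
  period \<open>n \<ge> 3\<close>.
\<close>

section \<open>Affine points and the point at infinity\<close>

lift_definition affine_point :: "'a::field \<Rightarrow> 'a proj_line" is "\<lambda>z. (z, 1)"
  by (auto simp: proj_rel_def intro: exI[of _ 1])

lift_definition infinity_point :: "'a::field proj_line" is "(1, 0)"
  by (auto simp: proj_rel_def intro: exI[of _ 1])

lemma affine_point_eq_iff: "affine_point z = affine_point w \<longleftrightarrow> z = w"
  by transfer (auto simp: proj_rel_def)

lemma affine_point_or_infinity:
  obtains z where "P = affine_point z" | "P = infinity_point"
proof -
  have "(\<exists>z. P = affine_point z) \<or> P = infinity_point"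
  proof transfer
    fix u :: "'a \<times> 'a"
    assume u: "proj_rel u u"
    show "(\<exists>z. proj_rel u (z, 1)) \<or> proj_rel u (1, 0)"
    proof (cases "snd u = 0")
      case True
      with u have "fst u \<noteq> 0"
        by (auto simp: proj_rel_def prod_eq_iff)
      with True have "proj_rel u (1, 0)"
        by (auto simp: proj_rel_def prod_eq_iff intro!: exI[of _ "1 / fst u"])
      then show ?thesis ..
    next
      case False
      then have "proj_rel u (fst u / snd u, 1)"
        by (auto simp: proj_rel_def prod_eq_iff intro!: exI[of _ "1 / snd u"])
      then show ?thesis by blast
    qed
  qed
  then show thesis
    using that by blast
qed

section \<open>The action of \<phi> on the projective line\<close>

lemma homog_linear: "homog (Suc 0) [:0, 1:] x y = x" "homog (Suc 0) 1 x y = y"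
  by (simp_all add: homog_def)

lemma homog_quadratic:
  "homog (Suc (Suc 0)) [:b, 0, 1:] x y = x\<^sup>2 + b * y\<^sup>2"
  "homog (Suc (Suc 0)) [:0, 1:] x y = x * y"
  by (simp_all add: homog_def power2_eq_square add.commute)

text \<open>A common divisor of z^2 + b and z divides b, which is a unit for b \<noteq> 0, so
  nothing cancels; the denominator z is monic, as \<open>normalized_fracts\<close> requires.
  \<open>rat_fun_map\<close> can then be evaluated from this pair, with d = 2.\<close>

lemma quot_of_fract_phi:
  fixes b :: "'a::field_gcd"
  assumes "b \<noteq> 0"
  shows "quot_of_fract (phi b) = ([:b, 0, 1:], [:0, 1:])"
proof -
  have "coprime [:b, 0, 1:] [:0, 1:]"
  proof (rule coprimeI)
    fix c :: "'a poly"
    assume c: "c dvd [:b, 0, 1:]" "c dvd [:0, 1:]"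
    have "[:b, 0, 1:] - [:0, 1:] * [:0, 1:] = [:b:]"
      by simp
    with c have "c dvd [:b:]"
      by (metis dvd_diff dvd_mult2)
    moreover have "is_unit [:b:]"
      using assms by (simp add: is_unit_const_poly_iff dvd_field_iff)
    ultimately show "is_unit c"
      by (rule dvd_trans)
  qed
  then have "([:b, 0, 1:], [:0, 1:]) \<in> normalized_fracts"
    by (simp add: normalized_fracts_def unit_factor_poly_def one_pCons)
  moreover have "phi b = quot_to_fract ([:b, 0, 1:], [:0, 1:])"
    by (simp add: phi_def quot_to_fract_def to_fract_def eq_fract)
  ultimately show ?thesis
    by (simp add: quot_of_fract_quot_to_fract')
qed

text \<open>Here z^2 / z cancels to z / 1, so the degree drops to 1 and 0 is no longer sent to
  infinity. This degenerate case has to be kept apart from b \<noteq> 0.\<close>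

lemma rat_fun_map_phi_zero: "rat_fun_map (phi 0) P = P"
proof -
  have "phi (0 :: 'a) = quot_to_fract ([:0, 1:], 1)"
    by (simp add: phi_def quot_to_fract_def to_fract_def eq_fract Zero_fract_def[symmetric])
  moreover have "([:0, 1 :: 'a:], 1) \<in> normalized_fracts"
    by (simp add: normalized_fracts_def)
  ultimately have "quot_of_fract (phi (0 :: 'a)) = ([:0, 1:], 1)"
    by (simp add: quot_of_fract_quot_to_fract')
  then show ?thesis
    by transfer (auto simp: homog_linear)
qed

lemma rat_fun_map_phi_infinity:
  "b \<noteq> 0 \<Longrightarrow> rat_fun_map (phi b) infinity_point = infinity_point"
  by transfer (simp add: quot_of_fract_phi homog_quadratic proj_rel_def exI[of _ 1])

lemma rat_fun_map_phi_affine_zero: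
  "b \<noteq> 0 \<Longrightarrow> rat_fun_map (phi b) (affine_point 0) = infinity_point"
proof transfer
  fix b :: 'a
  assume "b \<noteq> 0"
  then show "proj_rel (case (0, 1) of (x, y) \<Rightarrow>
      let (p, q) = quot_of_fract (phi b); d = max (degree p) (degree q)
      in (homog d p x y, homog d q x y)) (1, 0)"
    \<comment> \<open>The image of [0 : 1] is represented by (b, 0), hence the scalar 1/b.\<close>
    by (simp add: quot_of_fract_phi homog_quadratic proj_rel_def exI[of _ "1 / b"])
qed

lemma rat_fun_map_phi_affine:
  "b \<noteq> 0 \<Longrightarrow> z \<noteq> 0 \<Longrightarrow>
    rat_fun_map (phi b) (affine_point z) = affine_point (z + b / z)"
proof transfer
  fix b z :: 'a
  assume "b \<noteq> 0" "z \<noteq> 0"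
  \<comment> \<open>The image of [z : 1] is represented by (z^2 + b, z), hence the scalar
    1/z.\<close>
  then have "z + b / z = 1 / z * (z\<^sup>2 + b) \<and> 1 = 1 / z * z"
    by (simp add: distrib_left power2_eq_square)
  then have "\<exists>c. c \<noteq> 0 \<and> z + b / z = c * (z\<^sup>2 + b) \<and> 1 = c * z"
    using \<open>z \<noteq> 0\<close> by (intro exI[of _ "1 / z"]) simp
  then show "proj_rel (case (z, 1) of (x, y) \<Rightarrow>
      let (p, q) = quot_of_fract (phi b); d = max (degree p) (degree q)
      in (homog d p x y, homog d q x y)) (z + b / z, 1)"
    using \<open>b \<noteq> 0\<close> \<open>z \<noteq> 0\<close> by (simp add: quot_of_fract_phi homog_quadratic proj_rel_def)
qed

section \<open>Cycles of rational numbers\<close>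

lemma exists_common_denominator:
  fixes z :: "nat \<Rightarrow> rat"
  shows "\<exists>c::int. c > 0 \<and> (\<forall>i<n. of_int c * z i \<in> \<int>)"
proof (induction n)
  case 0
  show ?case by (auto intro: exI[of _ 1])
next
  case (Suc n)
  then obtain c :: int where c: "c > 0" "\<And>i. i < n \<Longrightarrow> of_int c * z i \<in> \<int>"
    by blast
  obtain r d where rd: "z n = of_int r / of_int d" "d > 0"
    by (metis quotient_of_denom_pos quotient_of_div surj_pair)
  have "of_int (d * c) * z i \<in> \<int>" if "i < Suc n" for i
  proof (cases "i = n")
    case True
    then have "of_int (d * c) * z i = of_int (c * r)"
      using rd by simp
    then show ?thesis
      by (metis Ints_of_int)
  next
    case False
    then have "of_int d * (of_int c * z i) \<in> \<int>"
      using that by (intro Ints_mult[OF Ints_of_int c(2)]) simp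
    then show ?thesis
      by (simp add: mult.assoc)
  qed
  then show ?case
    using c rd by (intro exI[of _ "d * c"]) auto
qed

text \<open>Integer form of the valuation argument, to be applied to a cycle cleared of
  denominators: with \<open>a i\<close> = c z_i and B = c^2 b, the recursion keeps its
  shape.\<close>

lemma multiplicity_periodic_orbit:
  fixes a :: "nat \<Rightarrow> int"
  assumes step: "\<And>i. a i * a (Suc i) = a i ^ 2 + B"
    and nz: "\<And>i. a i \<noteq> 0" and "B \<noteq> 0"
    and per: "\<And>i. a (i + n) = a i" and "n > 0" and "prime p"
  shows "multiplicity p (a i) = multiplicity p (a j)"
proof -
  define m where "m i = multiplicity p (a i)" for i
  define \<beta> where "\<beta> = multiplicity p B"
  have prod: "m i + m (Suc i) = multiplicity p (a i ^ 2 + B)" for i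
    using step[of i] nz prime_elem_multiplicity_mult_distrib[of p "a i" "a (Suc i)"]
      prime_imp_prime_elem[OF \<open>prime p\<close>]
    by (simp add: m_def)
  have sq: "multiplicity p (a i ^ 2) = 2 * m i" for i
    using nz prime_imp_prime_elem[OF \<open>prime p\<close>]
    by (simp add: m_def prime_elem_multiplicity_power_distrib)
  \<comment> \<open>The valuation of a sum is the minimum when the two valuations differ.\<close>
  have sum: "m i + m (Suc i) = min (2 * m i) \<beta>" if "2 * m i \<noteq> \<beta>" for i
    using multiplicity_sum_min[of p "a i ^ 2" B] that sq nz \<open>B \<noteq> 0\<close> prod
    by (simp add: \<beta>_def)
  have small: "m (i + k) = m i" if "2 * m i < \<beta>" for i k
  proof (induction k)
    case (Suc k)
    then show ?case
      using sum[of "i + k"] that by simp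
  qed simp
  have per': "m (i + k * n) = m i" for i k
  proof (induction k)
    case (Suc k)
    then show ?case
      using per[of "i + k * n"] by (simp add: m_def ac_simps)
  qed simp
  have "m i = m j"
  proof (cases "\<forall>i. 2 * m i = \<beta>")
    case True
    then show ?thesis
      by (metis mult_left_cancel zero_neq_numeral)
  next
    case False
    then obtain l where l: "2 * m l \<noteq> \<beta>"
      by blast
    obtain k where k: "2 * m k < \<beta>"
    proof (cases "2 * m l < \<beta>")
      case True
      then show ?thesis by (rule that)
    next
      case False
      \<comment> \<open>Now \<open>m l + m (Suc l) = \<beta>\<close> with \<open>m l\<close> above
        \<beta>/2, so \<open>m (Suc l)\<close> lies below it.\<close>
      then have "2 * m (Suc l) < \<beta>"
        using sum[OF l] l by simp
      then show ?thesis by (rule that)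
    qed
    have "m i = m k" for i
    proof -
      \<comment> \<open>Adding k full periods moves any index i past k, where \<open>small\<close>
        applies.\<close>
      have "k \<le> i + k * n"
        using \<open>n > 0\<close> by (simp add: trans_le_add2)
      then have "m (i + k * n) = m k"
        using small[OF k, of "i + k * n - k"] by simp
      then show ?thesis
        by (simp add: per')
    qed
    then show ?thesis by metis
  qed
  then show ?thesis
    by (simp add: m_def)
qed

text \<open>After scaling to integers, equal valuations at every prime force equal absolute values.
  Consecutive terms differ because b \<noteq> 0, so each step only flips the sign.\<close>

lemma rational_cycle_two_periodic:
  fixes z :: "nat \<Rightarrow> rat"
  assumes step: "\<And>i. z (Suc i) = z i + b / z i"
    and nz: "\<And>i. z i \<noteq> 0" and "b \<noteq> 0"
    and per: "\<And>i. z (i + n) = z i" and "n > 0"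
  shows "z 2 = z 0"
proof -
  obtain c :: int where c: "c > 0" "\<And>i. i < n \<Longrightarrow> of_int c * z i \<in> \<int>"
    using exists_common_denominator by blast
  have per': "z (i + k * n) = z i" for i k
  proof (induction k)
    case (Suc k)
    then show ?case
      using per[of "i + k * n"] by (simp add: ac_simps)
  qed simp
  have "of_int c * z i \<in> \<int>" for i
    using c(2)[of "i mod n"] per'[of "i mod n" "i div n"] \<open>n > 0\<close> by simp
  then have "\<forall>i. \<exists>k. of_int c * z i = of_int k"
    by (auto elim: Ints_cases)
  then obtain a :: "nat \<Rightarrow> int" where a: "\<And>i. of_int c * z i = of_int (a i)"
    by metis
  \<comment> \<open>B has to be c^2 b, which is not visibly an integer; solving the recursion at i =
    0 for it gives an integer expression.\<close>
  define B where "B = a 0 * (a 1 - a 0)"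
  have "z i * z (Suc i) = z i ^ 2 + b" for i
    using nz[of i] by (simp add: step[of i] distrib_left power2_eq_square)
  then have "of_int c ^ 2 * (z i * z (Suc i)) = of_int c ^ 2 * (z i ^ 2 + b)" for i
    by simp
  then have "(of_int c * z i) * (of_int c * z (Suc i)) = (of_int c * z i) ^ 2 + of_int c ^ 2 * b" for i
    by (simp only: power2_eq_square distrib_left mult_ac)
  then have prod: "of_int (a i * a (Suc i)) = of_int (a i ^ 2) + of_int c ^ 2 * b" for i
    by (simp only: a of_int_mult of_int_power)
  have B: "of_int B = of_int c ^ 2 * b"
    using prod[of 0] by (simp add: B_def power2_eq_square algebra_simps)
  have a_step: "a i * a (Suc i) = a i ^ 2 + B" for i
  proof -
    have "(of_int (a i * a (Suc i)) :: rat) = of_int (a i ^ 2 + B)"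
      using prod[of i] B by simp
    then show ?thesis
      by (simp only: of_int_eq_iff)
  qed
  have a_nz: "a i \<noteq> 0" for i
    using a[of i] nz[of i] c(1) by auto
  have "B \<noteq> 0"
    using B \<open>b \<noteq> 0\<close> c(1) by auto
  have "(of_int (a (i + n)) :: rat) = of_int (a i)" for i
    by (simp only: a[symmetric] per)
  then have a_per: "a (i + n) = a i" for i
    by (simp only: of_int_eq_iff)
  have "normalize (a i) = normalize (a j)" for i j
    using multiplicity_periodic_orbit[of a B n, OF a_step a_nz \<open>B \<noteq> 0\<close> a_per \<open>n > 0\<close>] a_nz
    by (intro multiplicity_eq_imp_eq) auto
  then have abs: "\<bar>a i\<bar> = \<bar>a j\<bar>" for i j
    by simp
  have "a (Suc i) = - a i" for i
  proof -
    have "a (Suc i) \<noteq> a i"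
      using a_step[of i] \<open>B \<noteq> 0\<close> by (auto simp: power2_eq_square)
    then show ?thesis
      using abs[of "Suc i" i] by (simp add: abs_eq_iff)
  qed
  then have "a 2 = a 0"
    by (simp add: numeral_2_eq_2)
  then have "of_int c * z 2 = of_int c * z 0"
    by (simp only: a)
  then show ?thesis
    using c(1) by simp
qed

section \<open>From periodic points to rational cycles\<close>

lemma funpow_periodic:
  assumes "(f ^^ n) P = P"
  shows "(f ^^ (k * n)) P = P"
  using assms by (induction k) (simp_all add: funpow_add)

text \<open>If n > 2, then P is not fixed, so b \<noteq> 0. The orbit avoids infinity, which is
  fixed, and 0, which maps to infinity; it is thus a cycle of nonzero rationals, and z_2 = z_0
  contradicts the minimality of n.\<close>

lemma exact_period_phi_le_two:
  fixes b :: rat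
  assumes ep: "exact_period (rat_fun_map (phi b)) n P"
  shows "n \<le> 2"
proof (rule ccontr)
  assume "\<not> n \<le> 2"
  then have "n > 2" by simp
  define f where "f = rat_fun_map (phi b)"
  from ep have fn: "(f ^^ n) P = P" and ne: "\<And>m. 0 < m \<Longrightarrow> m < n \<Longrightarrow> (f ^^ m) P \<noteq> P"
    by (auto simp: exact_period_def f_def)
  have f1: "f P \<noteq> P"
    using ne[of 1] \<open>n > 2\<close> by simp
  then have "b \<noteq> 0"
    by (auto simp: f_def rat_fun_map_phi_zero)
  then have f_inf: "f infinity_point = infinity_point"
    by (simp add: f_def rat_fun_map_phi_infinity)
  have fin: "(f ^^ i) P \<noteq> infinity_point" for i
  proof
    assume i: "(f ^^ i) P = infinity_point"
    have inf: "(f ^^ k) infinity_point = infinity_point" for k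
      by (induction k) (simp_all add: f_inf)
    \<comment> \<open>The time i * n is a return to P no earlier than i, but an orbit that has
      reached infinity stays there.\<close>
    have "i \<le> i * n"
      using \<open>n > 2\<close> by simp
    then have "(f ^^ (i * n)) P = (f ^^ (i * n - i)) ((f ^^ i) P)"
      by (metis comp_apply funpow_add le_add_diff_inverse2)
    then have "P = infinity_point"
      by (simp add: i inf funpow_periodic[OF fn])
    with f1 f_inf show False by simp
  qed
  then have "\<forall>i. \<exists>w. (f ^^ i) P = affine_point w"
    by (metis affine_point_or_infinity)
  then obtain z where z: "\<And>i. (f ^^ i) P = affine_point (z i)"
    by metis
  have nz: "z i \<noteq> 0" for i
  proof
    assume "z i = 0"
    then have "(f ^^ Suc i) P = infinity_point"
      using z[of i] \<open>b \<noteq> 0\<close> by (simp add: f_def rat_fun_map_phi_affine_zero)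
    with fin show False by blast
  qed
  have "affine_point (z (Suc i)) = affine_point (z i + b / z i)" for i
    using z[of "Suc i"] z[of i] rat_fun_map_phi_affine[OF \<open>b \<noteq> 0\<close> nz[of i]] by (simp add: f_def)
  then have step: "z (Suc i) = z i + b / z i" for i
    by (simp only: affine_point_eq_iff)
  have "affine_point (z (i + n)) = affine_point (z i)" for i
    by (simp add: z[symmetric] funpow_add fn)
  then have per: "z (i + n) = z i" for i
    by (simp only: affine_point_eq_iff)
  have "z 2 = z 0"
    using rational_cycle_two_periodic[of z b n, OF step nz \<open>b \<noteq> 0\<close> per] \<open>n > 2\<close> by simp
  then have "(f ^^ 2) P = P"
    using z[of 2] z[of 0] by simp
  with ne[of 2] \<open>n > 2\<close> show False by simp
qed

theorem theorem4p1:
  fixes b :: rat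
  shows "\<forall>n\<ge>5. \<not> (\<exists>P :: rat proj_line. exact_period (rat_fun_map (phi b)) n P)"
  using exact_period_phi_le_two by fastforce

end
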